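(* For every field $\mathbb F$, the graph parameter $\operatorname{vdcc}$, as a function on simple graphs, is not expressible as a graph homomorphism function over $\mathbb F$; that is, there is no $\mathbb F$-weighted graph $H$ such that $\operatorname{vdcc}(G)=\hom(G,H)$ for every simple graph $G$.
   Context: For a simple graph $G$, $\operatorname{vdcc}(G)=m\cdot1\in\mathbb F$ where $m$ is the number of edge subsets $E'\subseteq E(G)$ forming a set of vertex-disjoint cycles covering all vertices of $G$ (equivalently, every vertex of $G$ has degree exactly $2$ in $(V(G),E')$); the empty graph has $m=1$. An $\mathbb F$-weighted graph $H$ is given by $q=|V(H)|\ge0$, vertex weights $\alpha_1,\dots,\alpha_q\in\mathbb F\setminus\{0\}$ and a symmetric matrix $B=(\beta_{ij})\in\mathbb F^{q\times q}$; $\hom(G,H)=\sum_{\phi:V(G)\to[q]}\prod_{u\in V(G)}\alpha_{\phi(u)}\prod_{uv\in E(G)}\beta_{\phi(u)\phi(v)}$ (empty products equal $1$). *)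

theory Defs
  imports Main "HOL-Library.FuncSet"
begin

definition simple_graph :: "'v set \<Rightarrow> 'v set set \<Rightarrow> bool" where
  "simple_graph V E \<longleftrightarrow> finite V \<and> (\<forall>e\<in>E. e \<subseteq> V \<and> card e = 2)"

text \<open>A cycle is identified with its set of edges; since it has no isolated vertices, its vertex
  set is the union of its edges.\<close>

definition cycle_edges :: "'v list \<Rightarrow> 'v set set" where
  "cycle_edges xs = {{xs ! i, xs ! (Suc i mod length xs)} | i. i < length xs}"

definition is_cycle :: "'v set set \<Rightarrow> bool" where
  "is_cycle C \<longleftrightarrow> (\<exists>xs. distinct xs \<and> 3 \<le> length xs \<and> C = cycle_edges xs)"

definition is_vdcc :: "'v set \<Rightarrow> 'v set set \<Rightarrow> bool" where
  "is_vdcc V F \<longleftrightarrow> (\<exists>\<C>. (\<forall>C\<in>\<C>. is_cycle C) \<and>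
      (\<forall>C\<in>\<C>. \<forall>D\<in>\<C>. C \<noteq> D \<longrightarrow> \<Union>C \<inter> \<Union>D = {}) \<and>
      F = \<Union>\<C> \<and> V = \<Union>F)"

definition vdcc :: "'v set \<Rightarrow> 'v set set \<Rightarrow> 'f::field" where
  "vdcc V E = of_nat (card {F. F \<subseteq> E \<and> is_vdcc V F})"

text \<open>The weighted graph has vertices \<open>0, \<dots>, q - 1\<close>; values of \<open>\<alpha>\<close> and \<open>\<beta>\<close> at
  other arguments are irrelevant.\<close>

definition weighted_graph :: "nat \<Rightarrow> (nat \<Rightarrow> 'f::field) \<Rightarrow> (nat \<Rightarrow> nat \<Rightarrow> 'f) \<Rightarrow> bool" where
  "weighted_graph q \<alpha> \<beta> \<longleftrightarrow>
     (\<forall>i<q. \<alpha> i \<noteq> 0) \<and> (\<forall>i<q. \<forall>j<q. \<beta> i j = \<beta> j i)"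

text \<open>The factor contributed by an unordered edge is unique because \<open>\<beta>\<close> is symmetric;
  see \<open>edge_weight_doubleton\<close> below.\<close>

definition edge_weight :: "(nat \<Rightarrow> nat \<Rightarrow> 'f) \<Rightarrow> ('v \<Rightarrow> nat) \<Rightarrow> 'v set \<Rightarrow> 'f" where
  "edge_weight \<beta> \<phi> e = (THE b. \<exists>u v. e = {u, v} \<and> b = \<beta> (\<phi> u) (\<phi> v))"

definition graph_hom ::
    "'v set \<Rightarrow> 'v set set \<Rightarrow> nat \<Rightarrow> (nat \<Rightarrow> 'f::field) \<Rightarrow> (nat \<Rightarrow> nat \<Rightarrow> 'f) \<Rightarrow> 'f" where
  "graph_hom V E q \<alpha> \<beta> =
     (\<Sum>\<phi> \<in> V \<rightarrow>\<^sub>E {..<q}. (\<Prod>u\<in>V. \<alpha> (\<phi> u)) * (\<Prod>e\<in>E. edge_weight \<beta> \<phi> e))"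

lemma edge_weight_doubleton:
  assumes "weighted_graph q \<alpha> \<beta>" "\<phi> u < q" "\<phi> v < q"
  shows "edge_weight \<beta> \<phi> {u, v} = \<beta> (\<phi> u) (\<phi> v)"
  unfolding edge_weight_def
proof (rule the_equality)
  fix b assume "\<exists>u' v'. {u, v} = {u', v'} \<and> b = \<beta> (\<phi> u') (\<phi> v')"
  then show "b = \<beta> (\<phi> u) (\<phi> v)"
    using assms by (auto simp: doubleton_eq_iff weighted_graph_def)
qed blast

lemma Union_cycle_edges: "\<Union>(cycle_edges xs) = set xs"
proof
  show "\<Union>(cycle_edges xs) \<subseteq> set xs"
    by (auto simp: cycle_edges_def)
       (metis mod_less_divisor nth_mem gr_implies_not0 not_gr_zero)
  show "set xs \<subseteq> \<Union>(cycle_edges xs)"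
    unfolding cycle_edges_def in_set_conv_nth subset_iff by blast
qed

lemma cycle_degree:
  assumes d: "distinct xs" and n: "3 \<le> length xs" and v: "v \<in> set xs"
  shows "card {e \<in> cycle_edges xs. v \<in> e} = 2"
proof -
  let ?n = "length xs"
  obtain i where i: "i < ?n" "v = xs ! i"
    using v by (auto simp: in_set_conv_nth)
  define s where "s = Suc i mod ?n"
  define p where "p = (if i = 0 then ?n - 1 else i - 1)"
  have s_eq: "s = (if Suc i = ?n then 0 else Suc i)"
    using i(1) by (auto simp: s_def)
  then have s: "s < ?n" "s \<noteq> i"
    using n i(1) by (auto split: if_splits)
  have p: "p < ?n" "p \<noteq> i" "p \<noteq> s" "Suc p mod ?n = i"
    using n i(1) s_eq by (auto simp: p_def split: if_splits)
  have j: "j = p" if "j < ?n" "Suc j mod ?n = i" for j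
    using that n i by (auto simp: p_def mod_Suc split: if_splits)
  have "{e \<in> cycle_edges xs. v \<in> e} = {{xs ! i, xs ! s}, {xs ! p, xs ! i}}" (is "?L = ?R")
  proof
    show "?L \<subseteq> ?R"
    proof
      fix e assume "e \<in> ?L"
      then obtain k where k: "k < ?n" "e = {xs ! k, xs ! (Suc k mod ?n)}" "v \<in> e"
        by (auto simp: cycle_edges_def)
      have "Suc k mod ?n < ?n" using k(1) by (intro mod_less_divisor) linarith
      then have "k = i \<or> Suc k mod ?n = i"
        using k i d by (auto simp: nth_eq_iff_index_eq)
      then show "e \<in> ?R" using k j by (auto simp: s_def)
    qed
    show "?R \<subseteq> ?L"
      using i p s_def by (auto simp: cycle_edges_def) 
  qed
  moreover have "{xs ! i, xs ! s} \<noteq> {xs ! p, xs ! i}"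
    using d i s p by (auto simp: doubleton_eq_iff nth_eq_iff_index_eq)
  ultimately show ?thesis by simp
qed

lemma two_regular_imp_is_vdcc:
  assumes "finite V" "\<forall>e\<in>F. e \<subseteq> V \<and> card e = 2" "\<forall>v\<in>V. card {e \<in> F. v \<in> e} = 2"
  shows "is_vdcc V F"
  using assms
proof (induction "card V" arbitrary: V F rule: less_induct)
  case less
  note fin = less.prems(1) and E = less.prems(2) and deg = less.prems(3)
  show ?case
  proof (cases "V = {}")
    case True
    then have "F = {}" using E by fastforce
    then show ?thesis using True unfolding is_vdcc_def by (intro exI[of _ "{}"]) auto
  next
    case False
    define P where "P xs \<longleftrightarrow> xs \<noteq> [] \<and> distinct xs \<and> set xs \<subseteq> V \<and>
        (\<forall>i. Suc i < length xs \<longrightarrow> {xs ! i, xs ! Suc i} \<in> F)" for xs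
    obtain v0 where "v0 \<in> V" using False by blast
    then have "P [v0]" by (simp add: P_def)
    moreover have "\<forall>xs. P xs \<longrightarrow> length xs < Suc (card V)"
      unfolding P_def by (metis card_mono distinct_card fin le_imp_less_Suc)
    ultimately obtain xs where xs: "P xs" and max: "\<And>ys. P ys \<Longrightarrow> length ys \<le> length xs"
      using ex_has_greatest_nat[of P "[v0]" length "Suc (card V)"] by (metis less_imp_le)
    have d: "distinct xs" and sub: "set xs \<subseteq> V" and ne: "xs \<noteq> []"
      and adj: "\<And>i. Suc i < length xs \<Longrightarrow> {xs ! i, xs ! Suc i} \<in> F"
      using xs by (auto simp: P_def)
    define n where "n = length xs"
    have n0: "0 < n" using ne by (simp add: n_def)
    define x where "x = xs ! (n - 1)"
    have xV: "x \<in> V" using sub n0 by (auto simp: x_def n_def)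
    have nb: "\<exists>j < n - 1. e = {xs ! j, x}" if e: "e \<in> F" "x \<in> e" for e
    proof -
      obtain y where y: "e = {y, x}" "y \<noteq> x"
        using E e by (metis card_2_iff insert_commute insertE singletonD)
      have yV: "y \<in> V" using y E e by auto
      have "y \<in> set xs"
      proof (rule ccontr)
        assume "y \<notin> set xs"
        moreover have "{(xs @ [y]) ! i, (xs @ [y]) ! Suc i} \<in> F" if "Suc i < length (xs @ [y])" for i
        proof (cases "Suc i < n")
          case True
          then show ?thesis using adj[of i] by (simp add: nth_append n_def)
        next
          case False
          then have "i = n - 1" "Suc i = n" using that by (auto simp: n_def)
          then have "{(xs @ [y]) ! i, (xs @ [y]) ! Suc i} = {x, y}"
            using n0 by (simp add: nth_append x_def n_def)
          then show ?thesis using y(1) e(1) by (simp add: insert_commute)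
        qed
        ultimately have "P (xs @ [y])" using d sub yV by (auto simp: P_def)
        then show False using max by fastforce
      qed
      then obtain j where "j < n" "y = xs ! j" by (auto simp: in_set_conv_nth n_def)
      moreover have "j \<noteq> n - 1" using calculation y(2) unfolding x_def by blast
      ultimately have "j < n - 1" "e = {xs ! j, x}" using y(1) by simp_all
      then show ?thesis by blast
    qed
    obtain e1 e2 where e12: "e1 \<noteq> e2" "{e \<in> F. x \<in> e} = {e1, e2}"
      using bspec[OF deg xV] unfolding card_2_iff by blast
    then have "e1 \<in> F" "x \<in> e1" "e2 \<in> F" "x \<in> e2" by blast+
    moreover from this obtain j1 j2
      where "j1 < n - 1" "e1 = {xs ! j1, x}" "j2 < n - 1" "e2 = {xs ! j2, x}"
      using nb by meson
    ultimately obtain j where j: "j < n - 1" "j \<noteq> n - 2" "{xs ! j, x} \<in> F"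
      using e12(1) by (cases "j1 = n - 2") auto
    have n3: "3 \<le> n" using j by linarith
    have j0: "j = 0"
    proof (rule ccontr)
      assume "j \<noteq> 0"
      let ?a = "{xs ! (j - 1), xs ! j}" and ?b = "{xs ! j, xs ! Suc j}" and ?c = "{xs ! j, x}"
      have "?a \<in> F" using adj[of "j - 1"] j(1) \<open>j \<noteq> 0\<close> by (simp add: n_def)
      moreover have "?b \<in> F" using adj[of j] j(1) by (simp add: n_def)
      ultimately have "{?a, ?b, ?c} \<subseteq> {e \<in> F. xs ! j \<in> e}" using j(3) by blast
      moreover have "F \<subseteq> Pow V" using E by blast
      then have "finite {e \<in> F. xs ! j \<in> e}"
        using fin by (simp add: finite_subset)
      ultimately have le: "card {?a, ?b, ?c} \<le> card {e \<in> F. xs ! j \<in> e}"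
        by (rule card_mono[rotated])
      have lt: "j - 1 < n" "j < n" "Suc j < n" "n - 1 < n" using j n3 by linarith+
      have "j - 1 \<noteq> Suc j" "j - 1 \<noteq> n - 1" "Suc j \<noteq> n - 1" "j - 1 \<noteq> j" "j \<noteq> n - 1"
        using j(1,2) \<open>j \<noteq> 0\<close> by linarith+
      then have "xs ! (j - 1) \<noteq> xs ! Suc j" "xs ! (j - 1) \<noteq> x" "xs ! Suc j \<noteq> x"
        using lt d by (simp_all add: x_def n_def nth_eq_iff_index_eq)
      then have "?a \<noteq> ?b" "?a \<noteq> ?c" "?b \<noteq> ?c"
        by (auto simp only: doubleton_eq_iff)
      then have "card {?a, ?b, ?c} = 3" by simp
      moreover have "xs ! j \<in> V" using sub lt(2) by (auto simp: n_def)
      then have "card {e \<in> F. xs ! j \<in> e} = 2" using deg by blast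
      ultimately show False using le by linarith
    qed
    define C where "C = cycle_edges xs"
    have UC: "\<Union>C = set xs" by (simp add: C_def Union_cycle_edges)
    have CF: "C \<subseteq> F"
    proof
      fix e assume "e \<in> C"
      then obtain i where i: "i < n" "e = {xs ! i, xs ! (Suc i mod n)}"
        by (auto simp: C_def cycle_edges_def n_def)
      show "e \<in> F"
      proof (cases "Suc i = n")
        case True
        then show ?thesis using i j(3) j0 by (auto simp: x_def insert_commute)
      next
        case False
        then show ?thesis using i adj by (simp add: n_def)
      qed
    qed
    have meet: "e \<in> C" if "e \<in> F" "v \<in> e" "v \<in> set xs" for e v
    proof -
      have "card {e \<in> C. v \<in> e} = 2" using cycle_degree d n3 that by (simp add: C_def n_def)
      moreover have "card {e \<in> F. v \<in> e} = 2" using deg sub that by auto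
      moreover have "F \<subseteq> Pow V" using E by blast
      then have "finite {e \<in> F. v \<in> e}" using fin by (simp add: finite_subset)
      moreover have "{e \<in> C. v \<in> e} \<subseteq> {e \<in> F. v \<in> e}" using CF by auto
      ultimately have "{e \<in> C. v \<in> e} = {e \<in> F. v \<in> e}" by (metis card_subset_eq)
      then show ?thesis using that by blast
    qed
    have "is_vdcc (V - set xs) (F - C)"
    proof (rule less.hyps)
      have "hd xs \<in> set xs" using ne by simp
      then have "V - set xs \<subset> V" using sub by blast
      then show "card (V - set xs) < card V" using fin by (rule psubset_card_mono[rotated])
      show "finite (V - set xs)" using fin by simp
      show "\<forall>e\<in>F - C. e \<subseteq> V - set xs \<and> card e = 2" using E meet by blast
      show "\<forall>v\<in>V - set xs. card {e \<in> F - C. v \<in> e} = 2"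
      proof
        fix v assume v: "v \<in> V - set xs"
        then have "{e \<in> F - C. v \<in> e} = {e \<in> F. v \<in> e}" using UC by auto
        then show "card {e \<in> F - C. v \<in> e} = 2" using deg v by simp
      qed
    qed
    then obtain \<D> where D: "\<And>A. A \<in> \<D> \<Longrightarrow> is_cycle A"
      "\<And>A B. A \<in> \<D> \<Longrightarrow> B \<in> \<D> \<Longrightarrow> A \<noteq> B \<Longrightarrow> \<Union>A \<inter> \<Union>B = {}"
      "F - C = \<Union>\<D>" "V - set xs = \<Union>(F - C)"
      unfolding is_vdcc_def by (elim exE conjE) metis
    have cyc: "is_cycle C" using d n3 unfolding is_cycle_def C_def n_def by blast
    have disj: "\<Union>A \<inter> \<Union>C = {}" if "A \<in> \<D>" for A
    proof -
      have "\<Union>A \<subseteq> V - set xs" unfolding D(3,4) using that by (rule Union_mono[OF Union_upper])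
      then show ?thesis unfolding UC by blast
    qed
    have "F = C \<union> (F - C)" using CF by blast
    then have F: "F = \<Union>(insert C \<D>)" unfolding D(3) by simp
    have "V = set xs \<union> (V - set xs)" using sub by blast
    also have "\<dots> = \<Union>C \<union> \<Union>(F - C)" unfolding UC D(4) ..
    also have "\<dots> = \<Union>F" using CF by blast
    finally have V: "V = \<Union>F" .
    show ?thesis unfolding is_vdcc_def
    proof (intro exI[of _ "insert C \<D>"] conjI ballI impI)
      fix A assume "A \<in> insert C \<D>"
      then show "is_cycle A" using cyc D(1) by blast
    next
      fix A B assume AB: "A \<in> insert C \<D>" "B \<in> insert C \<D>" "A \<noteq> B"
      then consider "A = C" "B \<in> \<D>" | "B = C" "A \<in> \<D>" | "A \<in> \<D>" "B \<in> \<D>" by blast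
      then show "\<Union>A \<inter> \<Union>B = {}"
      proof cases
        case 1
        then show ?thesis using disj[of B] by (simp only: Int_commute)
      next
        case 2
        then show ?thesis using disj[of A] by (simp only:)
      next
        case 3
        then show ?thesis using D(2) AB(3) by blast
      qed
    qed (fact F V)+
  qed
qed

lemma is_vdcc_iff_two_regular:
  assumes G: "simple_graph V E" and F: "F \<subseteq> E"
  shows "is_vdcc V F \<longleftrightarrow> (\<forall>v\<in>V. card {e \<in> F. v \<in> e} = 2)"
proof
  assume "is_vdcc V F"
  then obtain \<C> where C: "\<forall>C\<in>\<C>. is_cycle C"
      "\<forall>C\<in>\<C>. \<forall>D\<in>\<C>. C \<noteq> D \<longrightarrow> \<Union>C \<inter> \<Union>D = {}" "F = \<Union>\<C>" "V = \<Union>F"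
    unfolding is_vdcc_def by blast
  show "\<forall>v\<in>V. card {e \<in> F. v \<in> e} = 2"
  proof
    fix v assume "v \<in> V"
    then obtain C where c: "C \<in> \<C>" "v \<in> \<Union>C" using C by blast
    then have "{e \<in> F. v \<in> e} = {e \<in> C. v \<in> e}" using C(2,3) by blast
    moreover obtain xs where "distinct xs" "3 \<le> length xs" "C = cycle_edges xs"
      using C(1) c by (auto simp: is_cycle_def)
    ultimately show "card {e \<in> F. v \<in> e} = 2"
      using cycle_degree Union_cycle_edges c(2) by metis
  qed
next
  assume "\<forall>v\<in>V. card {e \<in> F. v \<in> e} = 2"
  moreover have "finite V" "\<forall>e\<in>F. e \<subseteq> V \<and> card e = 2"
    using G F unfolding simple_graph_def by blast+
  ultimately show "is_vdcc V F" by (intro two_regular_imp_is_vdcc)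
qed

end

theory Submission
  imports Defs "HOL-Computational_Algebra.Polynomial"
begin

text \<open>Let \<open>G\<^sub>n\<close> be \<open>n\<close> copies of \<open>K\<^sub>4\<close> minus an edge, glued at a vertex of degree 2. A 2-factor of
  \<open>G\<^sub>n\<close> is a 4-cycle in one copy together with a triangle in each of the others, so there are \<open>n\<close> of
  them. A homomorphism function takes the value \<open>\<Sum>i<q. \<alpha> i * x i ^ n\<close> at \<open>G\<^sub>n\<close>, where \<open>x i\<close> is the
  contribution of one copy when the shared vertex is mapped to \<open>i\<close>. If these values agree for all
  \<open>n\<close>, then \<open>\<Sum>i<q. \<alpha> i * P (x i) = P' 1\<close> for every polynomial \<open>P\<close> by linearity. This fails for the
  product of \<open>X - 1\<close> and all \<open>X - x\<close> with \<open>x \<noteq> 1\<close> among the \<open>x i\<close>: it vanishes at every \<open>x i\<close>, but has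
  a simple root at 1.\<close>

section \<open>Weighted power sums against the sequence of natural numbers\<close>

lemma sum_powers_neq_of_nat:
  fixes \<alpha> x :: "'i \<Rightarrow> 'f::field"
  assumes fin: "finite I"
  shows "\<exists>n. (\<Sum>i\<in>I. \<alpha> i * x i ^ n) \<noteq> of_nat n"
proof (rule ccontr)
  define Q where "Q = (\<Prod>y\<in>x ` I - {1}. [:- y, 1:])"
  define P where "P = [:- 1, 1:] * Q"
  assume "\<nexists>n. (\<Sum>i\<in>I. \<alpha> i * x i ^ n) \<noteq> of_nat n"
  then have eq: "(\<Sum>i\<in>I. \<alpha> i * x i ^ n) = of_nat n" for n by blast
  have "(\<Sum>i\<in>I. \<alpha> i * poly P (x i)) = (\<Sum>i\<in>I. \<Sum>k\<le>degree P. coeff P k * (\<alpha> i * x i ^ k))"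
    by (simp add: poly_altdef sum_distrib_left ac_simps)
  also have "\<dots> = (\<Sum>k\<le>degree P. coeff P k * of_nat k)"
    by (subst sum.swap) (simp add: eq flip: sum_distrib_left)
  also have "\<dots> = poly (pderiv (\<Sum>k\<le>degree P. monom (coeff P k) k)) 1"
    by (simp add: higher_pderiv_sum[of 1, simplified] pderiv_monom poly_sum poly_monom mult.commute)
  also have "\<dots> = poly (pderiv P) 1" by (simp add: poly_as_sum_of_monoms)
  also have "\<dots> = poly Q 1" unfolding P_def pderiv_mult by (simp add: pderiv_pCons)
  \<comment> \<open>At 1 each factor of \<open>Q\<close> equals 1 - y with y \<noteq> 1, so the
    product is nonzero in every characteristic.\<close>
  also have "\<dots> \<noteq> 0" using fin by (auto simp: Q_def poly_prod)
  finally have "(\<Sum>i\<in>I. \<alpha> i * poly P (x i)) \<noteq> 0" .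
  moreover have "poly P (x i) = 0" if "i \<in> I" for i
    using that fin by (cases "x i = 1") (auto simp: P_def Q_def poly_prod)
  ultimately show False by simp
qed

section \<open>Homomorphism sums of the glued graphs\<close>

lemma sum_PiE_insert:
  assumes "a \<notin> S"
  shows "(\<Sum>\<phi>\<in>insert a S \<rightarrow>\<^sub>E T. g \<phi>) = (\<Sum>\<phi>\<in>S \<rightarrow>\<^sub>E T. \<Sum>y\<in>T. g (\<phi>(a := y)))"
proof -
  have "(\<Sum>\<phi>\<in>insert a S \<rightarrow>\<^sub>E T. g \<phi>) = (\<Sum>(y, \<phi>)\<in>T \<times> (S \<rightarrow>\<^sub>E T). g (\<phi>(a := y)))"
    unfolding PiE_insert_eq
    by (subst sum.reindex[OF inj_combinator[OF assms]]) (simp add: case_prod_beta comp_def)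
  also have "\<dots> = (\<Sum>\<phi>\<in>S \<rightarrow>\<^sub>E T. \<Sum>y\<in>T. g (\<phi>(a := y)))"
    by (subst sum.swap) (simp add: sum.cartesian_product)
  finally show ?thesis .
qed

lemma edge_weight_cong:
  assumes "\<And>v. v \<in> e \<Longrightarrow> \<phi> v = \<psi> v"
  shows "edge_weight \<beta> \<phi> e = edge_weight \<beta> \<psi> e"
proof -
  have "(\<exists>u v. e = {u, v} \<and> b = \<beta> (\<phi> u) (\<phi> v)) \<longleftrightarrow> (\<exists>u v. e = {u, v} \<and> b = \<beta> (\<psi> u) (\<psi> v))" for b
    using assms by (metis insertCI)
  then show ?thesis by (simp add: edge_weight_def)
qed

text \<open>Vertex 0 is shared by all copies, and the missing edge of copy \<open>j\<close> joins it
  to \<open>3*j+3\<close>. The numbering lets \<open>(v - 1) div 3\<close> recover the copy of a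
  vertex other than 0.\<close>

definition diamond :: "nat \<Rightarrow> nat set set" where
  "diamond j = {{0, 3*j+1}, {0, 3*j+2}, {3*j+1, 3*j+2}, {3*j+1, 3*j+3}, {3*j+2, 3*j+3}}"

lemma diamond_index: "e \<in> diamond i \<Longrightarrow> v \<in> e \<Longrightarrow> v \<noteq> 0 \<Longrightarrow> (v - 1) div 3 = i"
  by (auto simp: diamond_def)

lemma diamond_unique:
  assumes "e \<in> diamond i" "e \<in> diamond j"
  shows "i = j"
proof -
  \<comment> \<open>The larger endpoint of an edge is never the shared vertex 0, so it determines
    the copy.\<close>
  have "(Max e - 1) div 3 = k" if "e \<in> diamond k" for k
    using that by (auto simp: diamond_def)
  then show ?thesis using assms by metis
qed

definition diamonds :: "nat \<Rightarrow> nat set set" where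
  "diamonds n = (\<Union>j<n. diamond j)"

lemma simple_graph_diamonds: "simple_graph {..3*n} (diamonds n)"
  unfolding simple_graph_def diamonds_def diamond_def by (auto simp: card_insert_if)

text \<open>Here \<open>a\<close>, \<open>b\<close>, \<open>c\<close> are the images of
  \<open>3*j+1\<close>, \<open>3*j+2\<close>, \<open>3*j+3\<close>. The weight
  \<open>\<alpha> i\<close> of the shared vertex is left out, since gluing counts it once and not
  once per copy.\<close>

definition diamond_hom :: "nat \<Rightarrow> (nat \<Rightarrow> 'f::field) \<Rightarrow> (nat \<Rightarrow> nat \<Rightarrow> 'f) \<Rightarrow> nat \<Rightarrow> 'f" where
  "diamond_hom q \<alpha> \<beta> i =
     (\<Sum>a<q. \<Sum>b<q. \<Sum>c<q. \<alpha> a * \<alpha> b * \<alpha> c * (\<beta> i a * \<beta> i b * \<beta> a b * \<beta> a c * \<beta> b c))"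

text \<open>The extra weight \<open>h\<close> at the shared vertex absorbs the last copy in the induction step.\<close>

lemma diamonds_hom_weighted:
  assumes H: "weighted_graph q \<alpha> \<beta>"
  shows "(\<Sum>\<phi>\<in>{..3*n} \<rightarrow>\<^sub>E {..<q}. (\<Prod>u\<in>{..3*n}. \<alpha> (\<phi> u)) * (\<Prod>e\<in>diamonds n. edge_weight \<beta> \<phi> e) * h (\<phi> 0))
     = (\<Sum>i<q. \<alpha> i * diamond_hom q \<alpha> \<beta> i ^ n * h i)"
proof (induction n arbitrary: h)
  case 0
  show ?case
    using sum_PiE_insert[of 0 "{}" "\<lambda>\<phi>. \<alpha> (\<phi> 0) * h (\<phi> 0)" "{..<q}"] by (simp add: diamonds_def)
next
  case (Suc n)
  let ?V = "{..3*n}" and ?a = "3*n+1" and ?b = "3*n+2" and ?c = "3*n+3"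
  define W where "W V E \<phi> = (\<Prod>u\<in>V. \<alpha> (\<phi> u)) * (\<Prod>e\<in>E. edge_weight \<beta> \<phi> e)"
    for V :: "nat set" and E and \<phi>
  \<comment> \<open>Peeling off \<open>?c\<close> first and \<open>?a\<close> last makes the new
    sums appear in the order \<open>a\<close>, \<open>b\<close>, \<open>c\<close> used in
    \<open>diamond_hom\<close>.\<close>
  have V: "{..3 * Suc n} = insert ?c (insert ?b (insert ?a ?V))" by auto
  have sub: "v \<le> 3*n" if "v \<in> e" "e \<in> diamonds n" for v e
    using that by (auto simp: diamonds_def diamond_def)
  have E: "diamonds (Suc n) = diamonds n \<union> diamond n"
    by (auto simp: diamonds_def lessThan_Suc)
  have disj: "diamonds n \<inter> diamond n = {}"
    using diamond_unique by (fastforce simp: diamonds_def)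
  have fin: "finite (diamonds n)" "finite (diamond n)"
    by (auto simp: diamonds_def diamond_def)
  have step: "W {..3 * Suc n} (diamonds (Suc n)) (\<phi>(?a := a, ?b := b, ?c := c)) * h ((\<phi>(?a := a, ?b := b, ?c := c)) 0) =
      W ?V (diamonds n) \<phi> * h (\<phi> 0) *
      (\<alpha> a * \<alpha> b * \<alpha> c * (\<beta> (\<phi> 0) a * \<beta> (\<phi> 0) b * \<beta> a b * \<beta> a c * \<beta> b c))"
    if \<phi>: "\<phi> \<in> ?V \<rightarrow>\<^sub>E {..<q}" and abc: "a < q" "b < q" "c < q" for \<phi> a b c
  proof -
    define \<psi> where "\<psi> = \<phi>(?a := a, ?b := b, ?c := c)"
    have \<psi>: "\<psi> ?a = a" "\<psi> ?b = b" "\<psi> ?c = c" "\<psi> 0 = \<phi> 0" "\<And>v. v \<le> 3*n \<Longrightarrow> \<psi> v = \<phi> v"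
      by (auto simp: \<psi>_def)
    have "\<phi> 0 < q" using PiE_mem[OF \<phi>, of 0] by simp
    then have new: "(\<Prod>e\<in>diamond n. edge_weight \<beta> \<psi> e)
        = \<beta> (\<phi> 0) a * \<beta> (\<phi> 0) b * \<beta> a b * \<beta> a c * \<beta> b c"
      unfolding diamond_def using abc \<psi>(1-4)
      by (simp add: edge_weight_doubleton[OF H] doubleton_eq_iff mult.assoc)
    have old: "(\<Prod>e\<in>diamonds n. edge_weight \<beta> \<psi> e) = (\<Prod>e\<in>diamonds n. edge_weight \<beta> \<phi> e)"
      by (intro prod.cong refl edge_weight_cong \<psi>(5)) (rule sub)
    have "(\<Prod>u\<in>?V. \<alpha> (\<psi> u)) = (\<Prod>u\<in>?V. \<alpha> (\<phi> u))" by (intro prod.cong) (auto simp: \<psi>(5))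
    then have "(\<Prod>u\<in>{..3 * Suc n}. \<alpha> (\<psi> u)) = \<alpha> c * (\<alpha> b * (\<alpha> a * (\<Prod>u\<in>?V. \<alpha> (\<phi> u))))"
      unfolding V using \<psi>(1-3) by simp
    then show ?thesis
      unfolding \<psi>_def[symmetric] W_def E prod.union_disjoint[OF fin disj] new old \<psi>(4)
      by (simp add: ac_simps)
  qed
  have "(\<Sum>\<phi>\<in>{..3 * Suc n} \<rightarrow>\<^sub>E {..<q}. W {..3 * Suc n} (diamonds (Suc n)) \<phi> * h (\<phi> 0)) =
     (\<Sum>\<phi>\<in>?V \<rightarrow>\<^sub>E {..<q}. \<Sum>a<q. \<Sum>b<q. \<Sum>c<q.
        W {..3 * Suc n} (diamonds (Suc n)) (\<phi>(?a := a, ?b := b, ?c := c)) * h ((\<phi>(?a := a, ?b := b, ?c := c)) 0))"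
    by (subst V, subst sum_PiE_insert, simp, subst sum_PiE_insert, simp, subst sum_PiE_insert, simp, rule refl)
  also have "\<dots> = (\<Sum>\<phi>\<in>?V \<rightarrow>\<^sub>E {..<q}. \<Sum>a<q. \<Sum>b<q. \<Sum>c<q. W ?V (diamonds n) \<phi> * h (\<phi> 0) *
      (\<alpha> a * \<alpha> b * \<alpha> c * (\<beta> (\<phi> 0) a * \<beta> (\<phi> 0) b * \<beta> a b * \<beta> a c * \<beta> b c)))"
    by (intro sum.cong refl step) auto
  also have "\<dots> = (\<Sum>\<phi>\<in>?V \<rightarrow>\<^sub>E {..<q}. W ?V (diamonds n) \<phi> * (diamond_hom q \<alpha> \<beta> (\<phi> 0) * h (\<phi> 0)))"
    by (simp add: diamond_hom_def sum_distrib_left sum_distrib_right ac_simps)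
  also have "\<dots> = (\<Sum>i<q. \<alpha> i * diamond_hom q \<alpha> \<beta> i ^ n * (diamond_hom q \<alpha> \<beta> i * h i))"
    unfolding W_def by (rule Suc.IH)
  finally show ?case by (simp add: W_def ac_simps)
qed

lemma graph_hom_diamonds:
  assumes "weighted_graph q \<alpha> \<beta>"
  shows "graph_hom {..3*n} (diamonds n) q \<alpha> \<beta> = (\<Sum>i<q. \<alpha> i * diamond_hom q \<alpha> \<beta> i ^ n)"
  using diamonds_hom_weighted[OF assms, where h = "\<lambda>_. 1"] by (simp add: graph_hom_def)

section \<open>Two-factors of the glued graphs\<close>

text \<open>The edge set that forms a 4-cycle in the copies indexed by \<open>D\<close> and a triangle in the others.\<close>

definition detours :: "nat \<Rightarrow> nat set \<Rightarrow> nat set set" where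
  "detours n D = (\<Union>j<n. {{3*j+1, 3*j+3}, {3*j+2, 3*j+3}} \<union>
     (if j \<in> D then {{0, 3*j+1}, {0, 3*j+2}} else {{3*j+1, 3*j+2}}))"

lemma diamonds_incident:
  assumes "j < n"
  shows "{e \<in> diamonds n. 3*j+1 \<in> e} = {{0, 3*j+1}, {3*j+1, 3*j+2}, {3*j+1, 3*j+3}}"
    and "{e \<in> diamonds n. 3*j+2 \<in> e} = {{0, 3*j+2}, {3*j+1, 3*j+2}, {3*j+2, 3*j+3}}"
    and "{e \<in> diamonds n. 3*j+3 \<in> e} = {{3*j+1, 3*j+3}, {3*j+2, 3*j+3}}"
proof -
  have *: "{e \<in> diamonds n. v \<in> e} = {e \<in> diamond j. v \<in> e}" if "(v - 1) div 3 = j" "v \<noteq> 0" for v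
    using that assms diamond_index unfolding diamonds_def by blast
  show "{e \<in> diamonds n. 3*j+1 \<in> e} = {{0, 3*j+1}, {3*j+1, 3*j+2}, {3*j+1, 3*j+3}}"
    "{e \<in> diamonds n. 3*j+2 \<in> e} = {{0, 3*j+2}, {3*j+1, 3*j+2}, {3*j+2, 3*j+3}}"
    "{e \<in> diamonds n. 3*j+3 \<in> e} = {{3*j+1, 3*j+3}, {3*j+2, 3*j+3}}"
    by (subst *; force simp: diamond_def)+
qed

text \<open>Both edges at \<open>3*j+3\<close> are forced. Then \<open>3*j+1\<close> and
  \<open>3*j+2\<close> each need exactly one more edge: either the edge between them, closing a
  triangle, or both edges to 0, closing a 4-cycle.\<close>

lemma degree_two_iff:
  assumes F: "F \<subseteq> diamonds n" and j: "j < n"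
  shows "(\<forall>v\<in>{3*j+1, 3*j+2, 3*j+3}. card {e \<in> F. v \<in> e} = 2) \<longleftrightarrow>
     {3*j+1, 3*j+3} \<in> F \<and> {3*j+2, 3*j+3} \<in> F \<and>
     ({3*j+1, 3*j+2} \<in> F \<longleftrightarrow> {0, 3*j+1} \<notin> F) \<and> ({0, 3*j+2} \<in> F \<longleftrightarrow> {0, 3*j+1} \<in> F)"
proof -
  have *: "{e \<in> F. v \<in> e} = F \<inter> {e \<in> diamonds n. v \<in> e}" for v using F by blast
  show ?thesis
    unfolding ball_simps * diamonds_incident[OF j]
    by (auto simp: Int_insert_right doubleton_eq_iff card_insert_if)
qed

lemma mem_detours:
  assumes "j < n"
  shows "{3*j+1, 3*j+3} \<in> detours n D" "{3*j+2, 3*j+3} \<in> detours n D"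
    and "{3*j+1, 3*j+2} \<in> detours n D \<longleftrightarrow> j \<notin> D"
    and "{0, 3*j+1} \<in> detours n D \<longleftrightarrow> j \<in> D" "{0, 3*j+2} \<in> detours n D \<longleftrightarrow> j \<in> D"
proof -
  have *: "e \<in> detours n D \<longleftrightarrow> e \<in> {{3*j+1, 3*j+3}, {3*j+2, 3*j+3}} \<union>
     (if j \<in> D then {{0, 3*j+1}, {0, 3*j+2}} else {{3*j+1, 3*j+2}})"
    if e: "e \<in> diamond j" for e
  proof -
    \<comment> \<open>Distinct copies share no edge, so only the \<open>j\<close>-th member of the
      union can contain an edge of copy \<open>j\<close>.\<close>
    have "i = j" if "e \<in> {{3*i+1, 3*i+3}, {3*i+2, 3*i+3}} \<union>
       (if i \<in> D then {{0, 3*i+1}, {0, 3*i+2}} else {{3*i+1, 3*i+2}})" for i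
    proof -
      have "e \<in> diamond i" using that by (auto simp: diamond_def split: if_splits)
      then show ?thesis using diamond_unique e by metis
    qed
    then show ?thesis using assms unfolding detours_def by blast
  qed
  show "{3*j+1, 3*j+3} \<in> detours n D" "{3*j+2, 3*j+3} \<in> detours n D"
    and "{3*j+1, 3*j+2} \<in> detours n D \<longleftrightarrow> j \<notin> D"
    and "{0, 3*j+1} \<in> detours n D \<longleftrightarrow> j \<in> D" "{0, 3*j+2} \<in> detours n D \<longleftrightarrow> j \<in> D"
    by (subst *; simp add: diamond_def doubleton_eq_iff)+
qed

lemma detours_subset: "detours n D \<subseteq> diamonds n"
  unfolding detours_def diamonds_def diamond_def by (rule UN_mono) auto

text \<open>Without the condition at 0 the copies are independent, and each one chooses freely
  between triangle and 4-cycle.\<close>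

lemma degree_two_iff_detours:
  assumes F: "F \<subseteq> diamonds n"
  shows "(\<forall>v\<in>{..3*n} - {0}. card {e \<in> F. v \<in> e} = 2) \<longleftrightarrow> (\<exists>D\<subseteq>{..<n}. F = detours n D)"
    (is "?L \<longleftrightarrow> ?R")
proof -
  have "{..3*n} - {0} = (\<Union>j<n. {3*j+1, 3*j+2, 3*j+3})" (is "?A = ?B")
  proof
    show "?A \<subseteq> ?B"
    proof
      fix v assume "v \<in> ?A"
      then have "(v - 1) div 3 < n" "v \<in> {3*((v-1) div 3)+1, 3*((v-1) div 3)+2, 3*((v-1) div 3)+3}"
        by auto
      then show "v \<in> ?B" by blast
    qed
  qed auto
  then have "?L \<longleftrightarrow> (\<forall>j<n. \<forall>v\<in>{3*j+1, 3*j+2, 3*j+3}. card {e \<in> F. v \<in> e} = 2)" by auto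
  also have "\<dots> \<longleftrightarrow> ?R"
  proof
    assume *: "\<forall>j<n. \<forall>v\<in>{3*j+1, 3*j+2, 3*j+3}. card {e \<in> F. v \<in> e} = 2"
    \<comment> \<open>A copy forms a 4-cycle exactly when it uses an edge to 0; testing one of the
      two such edges suffices, as they occur together.\<close>
    define D where "D = {j. j < n \<and> {0, 3*j+1} \<in> F}"
    have "e \<in> F \<longleftrightarrow> e \<in> detours n D" if "e \<in> diamond j" "j < n" for e j
      using that * degree_two_iff[OF F \<open>j < n\<close>] mem_detours[OF \<open>j < n\<close>, of D]
      unfolding diamond_def D_def by auto
    then have "F = detours n D"
      using F detours_subset[of n D] unfolding diamonds_def by blast
    moreover have "D \<subseteq> {..<n}" by (auto simp: D_def)
    ultimately show ?R by blast
  next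
    assume ?R
    then obtain D where D: "F = detours n D" by blast
    show "\<forall>j<n. \<forall>v\<in>{3*j+1, 3*j+2, 3*j+3}. card {e \<in> F. v \<in> e} = 2"
    proof (intro allI impI)
      fix j assume "j < n"
      then show "\<forall>v\<in>{3*j+1, 3*j+2, 3*j+3}. card {e \<in> F. v \<in> e} = 2"
        unfolding degree_two_iff[OF F \<open>j < n\<close>] unfolding D by (simp only: mem_detours)
    qed
  qed
  finally show ?thesis .
qed

text \<open>Triangles avoid 0 and each 4-cycle has two edges there, so degree 2 at 0 will mean
  exactly one 4-cycle.\<close>

lemma degree_zero_detours:
  assumes "D \<subseteq> {..<n}"
  shows "card {e \<in> detours n D. 0 \<in> e} = 2 * card D"
proof -
  have "{e \<in> detours n D. 0 \<in> e} = (\<Union>j\<in>D. {{0, 3*j+1}, {0, 3*j+2}})"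
    using assms by (auto simp: detours_def split: if_splits)
  also have "card \<dots> = (\<Sum>j\<in>D. card {{0, 3*j+1}, {0, 3*j+2}})"
    using finite_subset[OF assms] by (intro card_UN_disjoint) (auto simp: doubleton_eq_iff; presburger)+
  also have "\<dots> = 2 * card D" by (simp add: doubleton_eq_iff)
  finally show ?thesis .
qed

lemma vdcc_diamonds: "vdcc {..3*n} (diamonds n) = of_nat n"
proof -
  have "{F. F \<subseteq> diamonds n \<and> is_vdcc {..3*n} F} = detours n ` {D. D \<subseteq> {..<n} \<and> card D = 1}"
    (is "?L = ?R")
  proof -
    have "F \<in> ?L \<longleftrightarrow> F \<in> ?R" for F
    proof (cases "F \<subseteq> diamonds n")
      case True
      have "(\<forall>v\<in>{..3*n}. P v) \<longleftrightarrow> P 0 \<and> (\<forall>v\<in>{..3*n} - {0}. P v)" for P :: "nat \<Rightarrow> bool"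
        by fastforce
      then have "is_vdcc {..3*n} F \<longleftrightarrow>
          card {e \<in> F. 0 \<in> e} = 2 \<and> (\<forall>v\<in>{..3*n} - {0}. card {e \<in> F. v \<in> e} = 2)"
        unfolding is_vdcc_iff_two_regular[OF simple_graph_diamonds True] .
      also have "\<dots> \<longleftrightarrow> F \<in> ?R"
        unfolding degree_two_iff_detours[OF True] using degree_zero_detours by auto
      finally show ?thesis using True by blast
    qed (use detours_subset in blast)
    then show ?thesis by blast
  qed
  moreover have "inj_on (detours n) {D. D \<subseteq> {..<n} \<and> card D = 1}"
    \<comment> \<open>The left inverse reads \<open>D\<close> off the edges at 0.\<close>
    using mem_detours(4) by (intro inj_on_inverseI[of _ "\<lambda>F. {j\<in>{..<n}. {0, 3*j+1} \<in> F}"]) auto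
  ultimately show ?thesis
    by (simp add: vdcc_def card_image n_subsets)
qed

theorem theorem4p7:
  shows "\<not> (\<exists>(q :: nat) (\<alpha> :: nat \<Rightarrow> 'f::field) (\<beta> :: nat \<Rightarrow> nat \<Rightarrow> 'f).
           weighted_graph q \<alpha> \<beta> \<and>
           (\<forall>(V :: nat set) (E :: nat set set).
              simple_graph V E \<longrightarrow> vdcc V E = graph_hom V E q \<alpha> \<beta>))"
proof
  assume "\<exists>(q :: nat) (\<alpha> :: nat \<Rightarrow> 'f) (\<beta> :: nat \<Rightarrow> nat \<Rightarrow> 'f).
           weighted_graph q \<alpha> \<beta> \<and>
           (\<forall>(V :: nat set) (E :: nat set set).
              simple_graph V E \<longrightarrow> vdcc V E = graph_hom V E q \<alpha> \<beta>)"
  then obtain q and \<alpha> :: "nat \<Rightarrow> 'f" and \<beta> where H: "weighted_graph q \<alpha> \<beta>"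
    and hom: "\<And>(V :: nat set) E. simple_graph V E \<Longrightarrow> vdcc V E = graph_hom V E q \<alpha> \<beta>"
    by blast
  have "(\<Sum>i<q. \<alpha> i * diamond_hom q \<alpha> \<beta> i ^ n) = of_nat n" for n
    using hom[OF simple_graph_diamonds, of n] by (simp add: vdcc_diamonds graph_hom_diamonds[OF H])
  then show False using sum_powers_neq_of_nat[of "{..<q}" \<alpha> "diamond_hom q \<alpha> \<beta>"] by blast
qed

end
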